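(* Let $\kappa_r>0$, $0<\kappa_\varepsilon<1$, and $x^*\in\mathbb{R}^2$. Starting at $t=0$ from any initial state $(x_0,\theta_0)\in\mathbb{R}^2\times[-\pi,\pi)$, the unicycle position trajectory $x(t)$ under the adaptive headway controller $u_{x^*}$ satisfies, for all $t\ge0$, $x(t)\in\mathcal{M}_{\mathrm B}(x_0,\theta_0)$, where $$\mathcal{M}_{\mathrm B}(x_0,\theta_0)=\begin{cases}\mathrm{B}(x^*,\|x_0-x^*\|), & \text{if } (\cos\theta_0,\sin\theta_0)\frac{x^*-x_0}{\|x^*-x_0\|}\ge\kappa_\varepsilon,\\ \mathrm{B}(x^*,\|\widehat{x}_0-x^*\|), & \text{otherwise,}\end{cases}$$ $\mathrm{B}(c,\rho)=\{z\in\mathbb{R}^2:\|z-c\|\le\rho\}$, and $\widehat{x}_0$ is the extended unicycle position associated with $(x_0,\theta_0)$.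
   Context: Write $o(\theta)=(\cos\theta,\sin\theta)^{\mathrm T}$ and $n(\theta)=(-\sin\theta,\cos\theta)^{\mathrm T}$. A unicycle state is $(x,\theta)$ with $x\in\mathbb{R}^2$, $\theta\in[-\pi,\pi)$ (an angle, understood modulo $2\pi$). Unicycle dynamics: $\dot x=v\,o(\theta)$, $\dot\theta=\omega$. The adaptive headway controller $u_{x^*}=(v_{x^*},\omega_{x^*})$ with gains $\kappa_r>0$, $0<\kappa_\varepsilon<1$ is, for $x\neq x^*$, $$v_{x^*}(x,\theta)=\frac{\kappa_r\|x^*-x\|\left(o(\theta)^{\mathrm T}\frac{x^*-x}{\|x^*-x\|}-\kappa_\varepsilon\right)}{1-\kappa_\varepsilon\, o(\theta)^{\mathrm T}\frac{x^*-x}{\|x^*-x\|}},\qquad \omega_{x^*}(x,\theta)=\frac{\kappa_r}{\kappa_\varepsilon}\,n(\theta)^{\mathrm T}\frac{x^*-x}{\|x^*-x\|},$$ and $v_{x^*}=\omega_{x^*}=0$ when $x=x^*$. Closed-loop trajectories are solutions of $\dot x=v_{x^*}(x,\theta)o(\theta)$, $\dot\theta=\omega_{x^*}(x,\theta)$. For a state $(x,\theta)$: the headway point is $x_\varepsilon=x+\varepsilon\,o(\theta)$ with $\varepsilon=\kappa_\varepsilon\|x-x^*\|$; the headway tangent is $\mathrm{t}_\varepsilon=\frac{x^*-x_\varepsilon}{\|x^*-x_\varepsilon\|}$ if $x_\varepsilon\ne x^*$ and $0$ otherwise; the headway normal is $\mathrm{n}_\varepsilon=R_{\pi/2}\mathrm{t}_\varepsilon$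 if $(x^*-x)^{\mathrm T}n(\theta)\ge0$ and $R_{-\pi/2}\mathrm{t}_\varepsilon$ otherwise, where $R_\phi$ is the counterclockwise rotation matrix by angle $\phi$; the projected unicycle position is $\check{x}=x^*+\mathrm{t}_\varepsilon\mathrm{t}_\varepsilon^{\mathrm T}(x-x^* )$; the extended unicycle position is $\widehat{x}=\check{x}+\frac{\kappa_\varepsilon}{\sqrt{1-\kappa_\varepsilon^2}}\|\check{x}-x^*\|\,\mathrm{n}_\varepsilon$. When $x=x^*$ (so the quotient in the case condition is undefined), both branches of $\mathcal{M}_{\mathrm B}$ equal $\{x^*\}$. *)

theory Defs
  imports "HOL-Analysis.Analysis"
begin

text \<open>
  Throughout, \<open>\<kappa>r\<close> and \<open>\<kappa>e\<close> are the gains $\kappa_r$ and $\kappa_\varepsilon$, \<open>xs\<close> is the goal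
  $x^*$, and \<open>(x, \<theta>)\<close> is a unicycle state.
\<close>

definition heading :: "real \<Rightarrow> real^2"
  where "heading \<theta> = vector [cos \<theta>, sin \<theta>]"

definition heading_normal :: "real \<Rightarrow> real^2"
  where "heading_normal \<theta> = vector [- sin \<theta>, cos \<theta>]"

definition rotation_matrix :: "real \<Rightarrow> real^2^2"
  where "rotation_matrix \<phi> = vector [vector [cos \<phi>, - sin \<phi>], vector [sin \<phi>, cos \<phi>]]"

text \<open>The adaptive headway controller.\<close>

definition goal_direction :: "real^2 \<Rightarrow> real^2 \<Rightarrow> real^2"
  where "goal_direction xs x = (xs - x) /\<^sub>R norm (xs - x)"

definition linear_velocity :: "real \<Rightarrow> real \<Rightarrow> real^2 \<Rightarrow> real^2 \<Rightarrow> real \<Rightarrow> real"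
  where "linear_velocity \<kappa>r \<kappa>e xs x \<theta> =
    (if x = xs then 0
     else \<kappa>r * norm (xs - x) * (heading \<theta> \<bullet> goal_direction xs x - \<kappa>e)
          / (1 - \<kappa>e * (heading \<theta> \<bullet> goal_direction xs x)))"

definition angular_velocity :: "real \<Rightarrow> real \<Rightarrow> real^2 \<Rightarrow> real^2 \<Rightarrow> real \<Rightarrow> real"
  where "angular_velocity \<kappa>r \<kappa>e xs x \<theta> =
    (if x = xs then 0
     else \<kappa>r / \<kappa>e * (heading_normal \<theta> \<bullet> goal_direction xs x))"

text \<open>
  Angles are understood modulo $2\pi$. A trajectory carries the continuous real-valued lift of its
  orientation, so \<open>\<theta> t\<close> may leave $[-\pi,\pi)$ for \<open>t > 0\<close>. At \<open>t = 0\<close> the derivatives are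
  one-sided.
\<close>

definition closed_loop_trajectory ::
    "real \<Rightarrow> real \<Rightarrow> real^2 \<Rightarrow> (real \<Rightarrow> real^2) \<Rightarrow> (real \<Rightarrow> real) \<Rightarrow> bool"
  where "closed_loop_trajectory \<kappa>r \<kappa>e xs x \<theta> \<longleftrightarrow>
    (\<forall>t\<ge>0.
      (x has_vector_derivative linear_velocity \<kappa>r \<kappa>e xs (x t) (\<theta> t) *\<^sub>R heading (\<theta> t))
        (at t within {0..}) \<and>
      (\<theta> has_real_derivative angular_velocity \<kappa>r \<kappa>e xs (x t) (\<theta> t)) (at t within {0..}))"

definition headway_point :: "real \<Rightarrow> real^2 \<Rightarrow> real^2 \<Rightarrow> real \<Rightarrow> real^2"
  where "headway_point \<kappa>e xs x \<theta> = x + (\<kappa>e * norm (x - xs)) *\<^sub>R heading \<theta>"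

definition headway_tangent :: "real \<Rightarrow> real^2 \<Rightarrow> real^2 \<Rightarrow> real \<Rightarrow> real^2"
  where "headway_tangent \<kappa>e xs x \<theta> =
    (if headway_point \<kappa>e xs x \<theta> \<noteq> xs
     then (xs - headway_point \<kappa>e xs x \<theta>) /\<^sub>R norm (xs - headway_point \<kappa>e xs x \<theta>)
     else 0)"

definition headway_normal :: "real \<Rightarrow> real^2 \<Rightarrow> real^2 \<Rightarrow> real \<Rightarrow> real^2"
  where "headway_normal \<kappa>e xs x \<theta> =
    (if (xs - x) \<bullet> heading_normal \<theta> \<ge> 0
     then rotation_matrix (pi / 2) *v headway_tangent \<kappa>e xs x \<theta>
     else rotation_matrix (- (pi / 2)) *v headway_tangent \<kappa>e xs x \<theta>)"

definition projected_position :: "real \<Rightarrow> real^2 \<Rightarrow> real^2 \<Rightarrow> real \<Rightarrow> real^2"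
  where "projected_position \<kappa>e xs x \<theta> =
    xs + (headway_tangent \<kappa>e xs x \<theta> \<bullet> (x - xs)) *\<^sub>R headway_tangent \<kappa>e xs x \<theta>"

definition extended_position :: "real \<Rightarrow> real^2 \<Rightarrow> real^2 \<Rightarrow> real \<Rightarrow> real^2"
  where "extended_position \<kappa>e xs x \<theta> =
    projected_position \<kappa>e xs x \<theta>
    + (\<kappa>e / sqrt (1 - \<kappa>e\<^sup>2) * norm (projected_position \<kappa>e xs x \<theta> - xs))
        *\<^sub>R headway_normal \<kappa>e xs x \<theta>"

definition motion_ball :: "real \<Rightarrow> real^2 \<Rightarrow> real^2 \<Rightarrow> real \<Rightarrow> (real^2) set"
  where "motion_ball \<kappa>e xs x \<theta> =
    (if heading \<theta> \<bullet> goal_direction xs x \<ge> \<kappa>e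
     then cball xs (norm (x - xs))
     else cball xs (norm (extended_position \<kappa>e xs x \<theta> - xs)))"

text \<open>
  At the goal the case condition of \<open>motion_ball\<close> involves a division by zero, but both branches
  are then the singleton of the goal, so the value chosen for the quotient is irrelevant.
\<close>

lemma motion_ball_goal: "motion_ball \<kappa>e xs xs \<theta> = {xs}"
  by (simp add: motion_ball_def extended_position_def projected_position_def)

end

theory Submission
  imports Defs
begin

text \<open>
  Let \<open>y = xs - x\<close> and \<open>p = xs - headway_point\<close>. Along a trajectory $p' = -\kappa_r p$, so \<open>p\<close> keeps
  its direction, and $|y - p| = \kappa_\varepsilon |y|$ confines \<open>y\<close> to an Apollonius circle.
  If the alignment condition holds initially, it persists, because $p_0 \cdot o(\theta)$ is
  nondecreasing; then $|y|$ is nonincreasing. Without alignment, $p_0 \cdot y$ is still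
  nonincreasing, and the circle gives
  $\sqrt{1 - \kappa_\varepsilon^2}\,|p|\,|y| \le p \cdot y$, with $p_0 \cdot y_0 / |p_0|$ equal to
  $\sqrt{1 - \kappa_\varepsilon^2}$ times the distance of the extended position from the goal.
\<close>

section \<open>Derivatives on the half-line\<close>

text \<open>Mean value theorem on [0, t]. Derivatives are taken within the half-line because those
  of a trajectory are one-sided at time 0.\<close>

lemma nondecreasing_from_zero:
  fixes f :: "real \<Rightarrow> real"
  assumes f: "\<And>s. s \<ge> 0 \<Longrightarrow> (f has_real_derivative f' s) (at s within {0..})"
    and nonneg: "\<And>s. s \<ge> 0 \<Longrightarrow> f' s \<ge> 0" and "t \<ge> 0"
  shows "f 0 \<le> f t"
proof (cases "t = 0")
  case False
  then have "\<exists>s\<in>{0<..<t}. f t - f 0 = f' s * (t - 0)"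
    using \<open>t \<ge> 0\<close>
    by (intro mvt_simple[where f' = "\<lambda>s. (*) (f' s)"])
      (auto intro!: has_derivative_subset[OF f[unfolded has_field_derivative_def]])
  then show ?thesis
    using nonneg \<open>t \<ge> 0\<close> by (metis diff_ge_0_iff_ge diff_zero greaterThanLessThan_iff
        less_eq_real_def mult_nonneg_nonneg)
qed simp

text \<open>A zero derivative means that \<open>f s\<close> is of smaller order than
  \<open>s - t\<close>, and so is its norm. This covers instants at the goal, where the norm itself
  is not differentiable.\<close>

lemma has_real_derivative_norm_at_zero:
  fixes f :: "real \<Rightarrow> 'a::real_normed_vector"
  assumes "(f has_vector_derivative 0) (at t within S)" "f t = 0"
  shows "((\<lambda>s. norm (f s)) has_real_derivative 0) (at t within S)"
  using assms
  by (simp add: has_vector_derivative_def has_field_derivative_def has_derivative_within_alt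
      bounded_linear_mult_right del: mult_zero_left)

section \<open>The moving frame\<close>

lemma inner_vector2: "vector [a, b] \<bullet> (z :: real^2) = a * z $ 1 + b * z $ 2"
  by (simp add: inner_vec_def sum_2)

lemma norm_heading: "norm (heading \<theta>) = 1"
  by (simp add: heading_def norm_eq_sqrt_inner inner_vector2 flip: power2_eq_square)

lemma heading_expansion:
  "(heading \<theta> \<bullet> z) *\<^sub>R heading \<theta> + (heading_normal \<theta> \<bullet> z) *\<^sub>R heading_normal \<theta> = z"
proof -
  have "(c * a + s * b) * c - (c * b - s * a) * s = a"
    and "(c * a + s * b) * s + (c * b - s * a) * c = b" if "s\<^sup>2 + c\<^sup>2 = 1" for a b c s :: real
    using that by algebra+
  then show ?thesis
    by (simp add: heading_def heading_normal_def vec_eq_iff forall_2 inner_vector2)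
qed

lemma heading_normal_inner_heading: "heading_normal \<theta> \<bullet> heading \<theta> = 0"
  by (simp add: heading_def heading_normal_def inner_vector2)

lemma heading_has_vector_derivative:
  assumes "(\<theta> has_real_derivative w) (at t within S)"
  shows "((\<lambda>s. heading (\<theta> s)) has_vector_derivative w *\<^sub>R heading_normal (\<theta> t)) (at t within S)"
proof -
  \<comment> \<open>Over constant basis vectors only the real coefficients need
    differentiating.\<close>
  have frame: "heading a = cos a *\<^sub>R axis 1 1 + sin a *\<^sub>R axis 2 1"
    "heading_normal a = (- sin a) *\<^sub>R axis 1 1 + cos a *\<^sub>R axis 2 1" for a
    by (simp_all add: heading_def heading_normal_def vec_eq_iff forall_2 axis_def)
  show ?thesis
    unfolding frame using assms
    by (auto intro!: derivative_eq_intros simp: algebra_simps)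
qed

lemma inner_goal_direction: "z \<bullet> goal_direction xs x = z \<bullet> (xs - x) / norm (xs - x)"
  by (simp add: goal_direction_def divide_inverse mult.commute)

text \<open>Clearing the normalization absorbs the case split: at the goal the factor
  \<open>norm (xs - x)\<close> makes the right-hand side 0.\<close>

lemma linear_velocity_eq:
  "linear_velocity \<kappa>r \<kappa>e xs x \<theta> =
    \<kappa>r * norm (xs - x) * (heading \<theta> \<bullet> (xs - x) - \<kappa>e * norm (xs - x))
      / (norm (xs - x) - \<kappa>e * (heading \<theta> \<bullet> (xs - x)))"
proof (cases "x = xs")
  case False
  define r a where "r = norm (xs - x)" and "a = heading \<theta> \<bullet> (xs - x)"
  have "r \<noteq> 0" using False by (simp add: r_def)
  then have "\<kappa>r * r * (a / r - \<kappa>e) / (1 - \<kappa>e * (a / r)) = \<kappa>r * r * (a - \<kappa>e * r) / (r - \<kappa>e * a)"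
    by (simp add: divide_simps)
  then show ?thesis
    using False by (simp add: linear_velocity_def inner_goal_direction r_def a_def)
qed (simp add: linear_velocity_def)

lemma angular_velocity_eq:
  "angular_velocity \<kappa>r \<kappa>e xs x \<theta> = \<kappa>r / \<kappa>e * (heading_normal \<theta> \<bullet> (xs - x) / norm (xs - x))"
  by (simp add: angular_velocity_def inner_goal_direction)

lemma abs_heading_inner_le: "\<bar>heading \<theta> \<bullet> z\<bar> \<le> norm z"
  using Cauchy_Schwarz_ineq2[of "heading \<theta>" z] by (simp add: norm_heading)

text \<open>Controls the denominator of the linear velocity: the weak form gives its sign
  everywhere, the strict form lets it cancel away from the goal.\<close>

lemma mult_heading_inner_le:
  assumes "0 < k" "k < 1"
  shows "k * (heading \<theta> \<bullet> z) \<le> norm z"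
    and "z \<noteq> 0 \<Longrightarrow> k * (heading \<theta> \<bullet> z) < norm z"
proof -
  have le: "k * (heading \<theta> \<bullet> z) \<le> k * norm z"
    using abs_heading_inner_le[of \<theta> z] assms by (simp add: abs_le_iff)
  have "k * norm z \<le> norm z"
    using assms by (simp add: mult_left_le_one_le)
  with le show "k * (heading \<theta> \<bullet> z) \<le> norm z" by simp
  show "k * (heading \<theta> \<bullet> z) < norm z" if "z \<noteq> 0"
  proof -
    have "k * norm z < norm z" using assms that by simp
    with le show ?thesis by linarith
  qed
qed

section \<open>Headway geometry\<close>

text \<open>Squaring the hypothesis gives \<open>2 * (p \<bullet> y)\<close> as a sum of two
  squares, and the AM-GM inequality bounds that sum below.\<close>

lemma apollonius_inner_ge:
  fixes p y :: "'a::real_inner"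
  assumes "norm (y - p) = k * norm y" "0 \<le> k" "k \<le> 1"
  shows "sqrt (1 - k\<^sup>2) * norm p * norm y \<le> p \<bullet> y"
proof -
  have "k\<^sup>2 \<le> 1" using assms by (simp add: power_le_one)
  moreover have "(norm (y - p))\<^sup>2 = (norm y)\<^sup>2 + (norm p)\<^sup>2 - 2 * (p \<bullet> y)"
    by (simp add: power2_norm_eq_inner inner_diff inner_commute)
  ultimately have "2 * (p \<bullet> y) = (sqrt (1 - k\<^sup>2) * norm y)\<^sup>2 + (norm p)\<^sup>2"
    using assms(1) by (simp add: power_mult_distrib algebra_simps)
  moreover have "2 * ((sqrt (1 - k\<^sup>2) * norm y) * norm p) \<le> \<dots>"
    using sum_squares_bound[of "sqrt (1 - k\<^sup>2) * norm y" "norm p"] by (simp add: mult.assoc)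
  ultimately show ?thesis by (simp add: mult_ac)
qed

lemma norm_extended_position:
  assumes "0 < k" "k < 1" and p: "p = xs - headway_point k xs x \<theta>" and "p \<noteq> 0"
  shows "norm (extended_position k xs x \<theta> - xs)
    = \<bar>p \<bullet> (xs - x)\<bar> / (norm p * sqrt (1 - k\<^sup>2))"
proof -
  define T where "T = headway_tangent k xs x \<theta>"
  define N where "N = headway_normal k xs x \<theta>"
  define m where "m = T \<bullet> (x - xs)"
  define c where "c = k / sqrt (1 - k\<^sup>2)"
  have k2: "k\<^sup>2 < 1" using assms by (simp add: power_less_one_iff)
  have T: "T = p /\<^sub>R norm p"
    using p \<open>p \<noteq> 0\<close> by (auto simp: T_def headway_tangent_def)
  have TT: "T \<bullet> T = 1"
    using \<open>p \<noteq> 0\<close> by (simp add: T flip: power2_norm_eq_inner)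
  have rot: "rotation_matrix (pi / 2) *v z = vector [- z $ 2, z $ 1]"
    "rotation_matrix (- (pi / 2)) *v z = vector [z $ 2, - z $ 1]" for z
    by (simp_all add: rotation_matrix_def vec_eq_iff forall_2 matrix_vector_mult_def sum_2)
  \<comment> \<open>Both rotations by a right angle preserve length and give a vector orthogonal to
    \<open>T\<close>.\<close>
  have NN: "N \<bullet> N = T \<bullet> T" and NT: "N \<bullet> T = 0"
    by (auto simp: N_def headway_normal_def rot inner_vec_def sum_2 simp flip: T_def)
  have "norm (m *\<^sub>R T) = \<bar>m\<bar>"
    using TT by (simp add: norm_eq_sqrt_inner)
  then have E: "extended_position k xs x \<theta> - xs = m *\<^sub>R T + (c * \<bar>m\<bar>) *\<^sub>R N"
    unfolding extended_position_def projected_position_def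
    by (simp flip: T_def N_def m_def c_def)
  have "(norm (m *\<^sub>R T + (c * \<bar>m\<bar>) *\<^sub>R N))\<^sup>2 = m\<^sup>2 * (1 + c\<^sup>2)"
    unfolding power2_norm_eq_inner using TT NN NT
    by (simp add: inner_add inner_commute algebra_simps power2_eq_square)
  \<comment> \<open>The ratio \<open>c\<close> is the tangent of the angle whose sine is
    \<open>k\<close>, so this is the inverse squared cosine.\<close>
  also have "1 + c\<^sup>2 = 1 / (1 - k\<^sup>2)"
    using k2 by (simp add: c_def power_divide field_simps)
  finally have "norm (extended_position k xs x \<theta> - xs) = sqrt (m\<^sup>2 * (1 / (1 - k\<^sup>2)))"
    unfolding E by (metis norm_ge_zero real_sqrt_unique)
  also have "\<dots> = \<bar>m\<bar> / sqrt (1 - k\<^sup>2)"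
    by (simp add: real_sqrt_divide)
  also have "m = - (p \<bullet> (xs - x) / norm p)"
    unfolding m_def T minus_diff_eq[of xs x, symmetric] inner_minus_right
    by (simp only: inner_scaleR_left divide_inverse mult.commute)
  finally show ?thesis by simp
qed

section \<open>Closed-loop motion\<close>

locale headway_motion =
  fixes \<kappa>r \<kappa>e :: real and xs :: "real^2" and x :: "real \<Rightarrow> real^2" and \<theta> :: "real \<Rightarrow> real"
  assumes \<kappa>r: "\<kappa>r > 0" and \<kappa>e: "0 < \<kappa>e" "\<kappa>e < 1"
    and trajectory: "closed_loop_trajectory \<kappa>r \<kappa>e xs x \<theta>"
begin

abbreviation "v t \<equiv> linear_velocity \<kappa>r \<kappa>e xs (x t) (\<theta> t)"
abbreviation "\<omega> t \<equiv> angular_velocity \<kappa>r \<kappa>e xs (x t) (\<theta> t)"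
abbreviation "h t \<equiv> heading (\<theta> t)"
abbreviation "n t \<equiv> heading_normal (\<theta> t)"

definition "y t = xs - x t"
definition "p t = y t - (\<kappa>e * norm (y t)) *\<^sub>R h t"

lemma p_eq_headway: "p t = xs - headway_point \<kappa>e xs (x t) (\<theta> t)"
  by (simp add: p_def y_def headway_point_def norm_minus_commute)

lemma norm_y_minus_p: "norm (y t - p t) = \<kappa>e * norm (y t)"
  using \<kappa>e by (simp add: p_def norm_heading)

text \<open>Away from the goal, dividing by \<open>norm (y t)\<close> turns the right-hand side into
  the alignment minus \<open>\<kappa>e\<close>, so the sign of \<open>h t \<bullet> p t\<close>
  decides the alignment condition.\<close>

lemma heading_inner_p: "h t \<bullet> p t = h t \<bullet> y t - \<kappa>e * norm (y t)"
  by (simp add: p_def inner_diff_right norm_heading flip: power2_norm_eq_inner)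

lemma normal_inner_p: "n t \<bullet> p t = n t \<bullet> y t"
  by (simp add: p_def inner_diff_right heading_normal_inner_heading)

lemma v_eq: "v t = \<kappa>r * norm (y t) * (h t \<bullet> p t) / (norm (y t) - \<kappa>e * (h t \<bullet> y t))"
  unfolding linear_velocity_eq heading_inner_p y_def ..

lemma \<omega>_eq: "\<omega> t = \<kappa>r / \<kappa>e * (n t \<bullet> y t / norm (y t))"
  unfolding angular_velocity_eq y_def ..

section \<open>Exponential decay of the headway error\<close>

lemma y_deriv: "t \<ge> 0 \<Longrightarrow> (y has_vector_derivative - v t *\<^sub>R h t) (at t within {0..})"
  using trajectory unfolding closed_loop_trajectory_def y_def[abs_def]
  by (auto intro!: derivative_eq_intros)

lemma h_deriv:
  "t \<ge> 0 \<Longrightarrow> ((\<lambda>t. h t) has_vector_derivative \<omega> t *\<^sub>R n t) (at t within {0..})"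
  using trajectory unfolding closed_loop_trajectory_def
  by (intro heading_has_vector_derivative) auto

text \<open>In the moving frame, \<open>v\<close> governs the heading component of the derivative
  and \<open>\<omega>\<close> the normal one; the controller makes each equal to
  \<open>- \<kappa>r\<close> times that component of \<open>p t\<close>.\<close>

lemma p_deriv:
  assumes "t \<ge> 0"
  shows "(p has_vector_derivative - \<kappa>r *\<^sub>R p t) (at t within {0..})"
proof -
  \<comment> \<open>The derivative of \<open>norm (y t)\<close>; it is 0 at the goal because
    \<open>v t\<close> vanishes there.\<close>
  define r' where "r' = (if y t = 0 then 0 else - v t * (h t \<bullet> y t) / norm (y t))"
  have r: "((\<lambda>t. norm (y t)) has_real_derivative r') (at t within {0..})"
  proof (cases "y t = 0")
    case True
    then have "v t = 0" by (simp add: v_eq)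
    then show ?thesis
      using True y_deriv[OF assms] by (simp add: r'_def has_real_derivative_norm_at_zero)
  next
    case False
    have "((\<lambda>t. norm (y t)) has_derivative (\<lambda>d. (d *\<^sub>R (- v t *\<^sub>R h t)) \<bullet> sgn (y t))) (at t within {0..})"
      by (rule has_derivative_compose[OF y_deriv[OF assms, unfolded has_vector_derivative_def]
            has_derivative_norm[OF False]])
    moreover have "(\<lambda>d. (d *\<^sub>R (- v t *\<^sub>R h t)) \<bullet> sgn (y t)) = (*) r'"
      using False by (simp add: fun_eq_iff r'_def sgn_div_norm divide_inverse mult_ac)
    ultimately show ?thesis
      by (simp only: has_field_derivative_def)
  qed
  have "(p has_vector_derivative
      - v t *\<^sub>R h t - ((\<kappa>e * norm (y t)) *\<^sub>R (\<omega> t *\<^sub>R n t) + (\<kappa>e * r') *\<^sub>R h t)) (at t within {0..})"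
    unfolding p_def[abs_def]
    by (intro has_vector_derivative_diff has_vector_derivative_scaleR y_deriv h_deriv DERIV_cmult r
        assms)
  moreover have "- v t *\<^sub>R h t - ((\<kappa>e * norm (y t)) *\<^sub>R (\<omega> t *\<^sub>R n t) + (\<kappa>e * r') *\<^sub>R h t) = - \<kappa>r *\<^sub>R p t"
  proof -
    have hc: "- v t - \<kappa>e * r' = - \<kappa>r * (h t \<bullet> p t)"
    proof (cases "y t = 0")
      case True
      then show ?thesis by (simp add: v_eq r'_def p_def)
    next
      case False
      \<comment> \<open>\<open>D\<close> is the denominator of \<open>v t\<close>. The change of
        \<open>norm (y t)\<close> rescales \<open>v t\<close> by \<open>D / norm (y t)\<close>,
        which the controller cancels.\<close>
      define D where "D = norm (y t) - \<kappa>e * (h t \<bullet> y t)"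
      have "D \<noteq> 0"
        using mult_heading_inner_le(2)[OF \<kappa>e False, of "\<theta> t"] by (simp add: D_def)
      have "- v t - \<kappa>e * r' = - v t * D / norm (y t)"
        using False by (simp add: r'_def D_def field_simps)
      also have "\<dots> = - \<kappa>r * (h t \<bullet> p t)"
        using False \<open>D \<noteq> 0\<close> by (simp add: v_eq flip: D_def)
      finally show ?thesis .
    qed
    have nc: "\<kappa>e * norm (y t) * \<omega> t = \<kappa>r * (n t \<bullet> p t)"
      using \<kappa>e by (simp add: \<omega>_eq normal_inner_p)
    have "- v t *\<^sub>R h t - ((\<kappa>e * norm (y t)) *\<^sub>R (\<omega> t *\<^sub>R n t) + (\<kappa>e * r') *\<^sub>R h t)
        = (- v t - \<kappa>e * r') *\<^sub>R h t - (\<kappa>e * norm (y t) * \<omega> t) *\<^sub>R n t"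
      by (simp add: algebra_simps)
    also have "\<dots> = - \<kappa>r *\<^sub>R ((h t \<bullet> p t) *\<^sub>R h t + (n t \<bullet> p t) *\<^sub>R n t)"
      unfolding hc nc by (simp add: algebra_simps)
    finally show ?thesis by (simp only: heading_expansion)
  qed
  ultimately show ?thesis by simp
qed

text \<open>Integrating factor \<open>exp (\<kappa>r * t)\<close>. Its positivity carries signs over
  between \<open>p 0\<close> and \<open>p t\<close>.\<close>

lemma p0_eq:
  assumes "t \<ge> 0"
  shows "p 0 = exp (\<kappa>r * t) *\<^sub>R p t"
proof -
  have "((\<lambda>t. exp (\<kappa>r * t) *\<^sub>R p t) has_vector_derivative 0) (at s within {0..})"
    if "s \<in> {0..}" for s
  proof -
    have "((\<lambda>t. exp (\<kappa>r * t)) has_real_derivative exp (\<kappa>r * s) * \<kappa>r) (at s within {0..})"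
      by (rule derivative_eq_intros refl | simp)+
    from has_vector_derivative_scaleR[OF this p_deriv] that show ?thesis
      by (simp add: mult.commute)
  qed
  then obtain c where "exp (\<kappa>r * s) *\<^sub>R p s = c" if "s \<in> {0..}" for s
    using has_vector_derivative_zero_constant[of "{0..}" "\<lambda>s. exp (\<kappa>r * s) *\<^sub>R p s"]
    by auto
  from this[of 0] this[of t] assms show ?thesis by simp
qed

section \<open>Monotone quantities along the motion\<close>

lemma v_mult_heading_inner_p_nonneg: "0 \<le> v t * (h t \<bullet> p t)"
proof -
  have "v t * (h t \<bullet> p t) =
      \<kappa>r * norm (y t) * (h t \<bullet> p t)\<^sup>2 / (norm (y t) - \<kappa>e * (h t \<bullet> y t))"
    by (simp add: v_eq power2_eq_square)
  then show ?thesis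
    using \<kappa>r mult_heading_inner_le(1)[OF \<kappa>e, of "\<theta> t" "y t"] by simp
qed

text \<open>Since \<open>p 0\<close> is fixed, only \<open>y\<close> is differentiated; the rate of
  decrease is a positive multiple of \<open>v s * (h s \<bullet> p s)\<close>.\<close>

lemma p0_inner_y_nonincreasing:
  assumes "t \<ge> 0"
  shows "p 0 \<bullet> y t \<le> p 0 \<bullet> y 0"
proof -
  have "- (p 0 \<bullet> y 0) \<le> - (p 0 \<bullet> y t)"
  proof (rule nondecreasing_from_zero[OF _ _ assms])
    fix s :: real assume s: "s \<ge> 0"
    show "((\<lambda>s. - (p 0 \<bullet> y s)) has_real_derivative v s * (p 0 \<bullet> h s)) (at s within {0..})"
      using has_vector_derivative_minus[OF
          bounded_linear.has_vector_derivative[OF bounded_linear_inner_right y_deriv[OF s]]]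
      by (simp add: has_real_derivative_iff_has_vector_derivative)
    have "v s * (p 0 \<bullet> h s) = exp (\<kappa>r * s) * (v s * (h s \<bullet> p s))"
      unfolding p0_eq[OF s] by (simp add: inner_commute)
    then show "0 \<le> v s * (p 0 \<bullet> h s)"
      using v_mult_heading_inner_p_nonneg by (simp only: exp_ge_zero mult_nonneg_nonneg)
  qed
  then show ?thesis by simp
qed

text \<open>Turning never lowers \<open>p 0 \<bullet> h s\<close>: as
  \<open>n s \<bullet> p s = n s \<bullet> y s\<close>, its rate is a nonnegative multiple of a
  square.\<close>

lemma aligned_forever:
  assumes "0 \<le> h 0 \<bullet> p 0" "t \<ge> 0"
  shows "0 \<le> h t \<bullet> p t"
proof -
  have "p 0 \<bullet> h 0 \<le> p 0 \<bullet> h t"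
  proof (rule nondecreasing_from_zero[OF _ _ assms(2)])
    fix s :: real assume s: "s \<ge> 0"
    show "((\<lambda>s. p 0 \<bullet> h s) has_real_derivative \<omega> s * (p 0 \<bullet> n s)) (at s within {0..})"
      using bounded_linear.has_vector_derivative[OF bounded_linear_inner_right h_deriv[OF s]]
      by (simp add: has_real_derivative_iff_has_vector_derivative)
    have "\<omega> s * (p 0 \<bullet> n s) = exp (\<kappa>r * s) * (\<kappa>r / \<kappa>e * ((n s \<bullet> y s)\<^sup>2 / norm (y s)))"
      unfolding p0_eq[OF s]
      by (simp add: \<omega>_eq inner_commute[of "p s"] normal_inner_p power2_eq_square)
    then show "0 \<le> \<omega> s * (p 0 \<bullet> n s)"
      using \<kappa>r \<kappa>e by simp
  qed
  with assms show ?thesis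
    unfolding p0_eq[OF assms(2)] by (simp add: inner_commute zero_le_mult_iff)
qed

lemma aligned_norm_y_le:
  assumes "0 \<le> h 0 \<bullet> p 0" "t \<ge> 0"
  shows "norm (y t) \<le> norm (y 0)"
proof -
  have "- (y 0 \<bullet> y 0) \<le> - (y t \<bullet> y t)"
  proof (rule nondecreasing_from_zero[OF _ _ assms(2)])
    fix s :: real assume s: "s \<ge> 0"
    show "((\<lambda>s. - (y s \<bullet> y s)) has_real_derivative 2 * (v s * (h s \<bullet> y s))) (at s within {0..})"
      using y_deriv[OF s]
      unfolding has_field_derivative_def has_vector_derivative_def
      by (auto intro!: derivative_eq_intros simp: inner_commute fun_eq_iff)
    have "0 \<le> h s \<bullet> p s" by (rule aligned_forever[OF assms(1) s])
    moreover have "0 \<le> \<kappa>e * norm (y s)" using \<kappa>e by simp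
    \<comment> \<open>Alignment makes both \<open>v s\<close> and \<open>h s \<bullet> y s\<close>
      nonnegative, hence the product below.\<close>
    ultimately have "0 \<le> h s \<bullet> p s" "0 \<le> h s \<bullet> y s"
      unfolding heading_inner_p by linarith+
    then show "0 \<le> 2 * (v s * (h s \<bullet> y s))"
      using \<kappa>r mult_heading_inner_le(1)[OF \<kappa>e, of "\<theta> s" "y s"] by (simp add: v_eq)
  qed
  then show ?thesis by (simp add: norm_eq_sqrt_inner)
qed

section \<open>Containment in the motion ball\<close>

lemma norm_y_le_extended:
  assumes "t \<ge> 0"
  shows "norm (y t) \<le> norm (extended_position \<kappa>e xs (x 0) (\<theta> 0) - xs)"
proof (cases "p 0 = 0")
  case True
  \<comment> \<open>With the headway point at the goal,
    \<open>norm (y t) = \<kappa>e * norm (y t)\<close> and \<open>\<kappa>e < 1\<close> force the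
    position to be the goal as well.\<close>
  then have "p t = 0" using p0_eq[OF assms] by simp
  then have "y t = 0" using norm_y_minus_p[of t] \<kappa>e by simp
  then show ?thesis by simp
next
  case False
  have k: "sqrt (1 - \<kappa>e\<^sup>2) > 0" using \<kappa>e by (simp add: power_less_one_iff)
  have "sqrt (1 - \<kappa>e\<^sup>2) * norm (p t) * norm (y t) \<le> p t \<bullet> y t"
    using norm_y_minus_p \<kappa>e by (intro apollonius_inner_ge) auto
  \<comment> \<open>Both sides are homogeneous in \<open>p t\<close>, so the positive exponential
    factor replaces it by \<open>p 0\<close>.\<close>
  then have "sqrt (1 - \<kappa>e\<^sup>2) * norm (p 0) * norm (y t) \<le> p 0 \<bullet> y t"
    unfolding p0_eq[OF assms] by (simp add: mult.left_commute mult.assoc)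
  also have "\<dots> \<le> \<bar>p 0 \<bullet> y 0\<bar>"
    using p0_inner_y_nonincreasing[OF assms] by simp
  finally have "norm (y t) \<le> \<bar>p 0 \<bullet> y 0\<bar> / (norm (p 0) * sqrt (1 - \<kappa>e\<^sup>2))"
    using k False by (simp add: pos_le_divide_eq mult_ac)
  then show ?thesis
    using norm_extended_position[OF \<kappa>e p_eq_headway False] by (simp add: y_def)
qed

lemma in_motion_ball:
  assumes "t \<ge> 0"
  shows "x t \<in> motion_ball \<kappa>e xs (x 0) (\<theta> 0)"
proof (cases "heading (\<theta> 0) \<bullet> goal_direction xs (x 0) \<ge> \<kappa>e")
  case True
  have "0 \<le> h 0 \<bullet> p 0"
  \<comment> \<open>The normalization can be cleared only away from the goal; at the goal
    \<open>p 0 = 0\<close>.\<close>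
  proof (cases "y 0 = 0")
    case False
    then show ?thesis
      using True unfolding heading_inner_p y_def
      by (simp add: inner_goal_direction pos_le_divide_eq)
  qed (simp add: p_def)
  from aligned_norm_y_le[OF this assms] show ?thesis
    using True by (simp add: motion_ball_def y_def dist_norm norm_minus_commute)
next
  case False
  then show ?thesis
    using norm_y_le_extended[OF assms] by (simp add: motion_ball_def y_def dist_norm)
qed

end

theorem proposition2:
  fixes \<kappa>r \<kappa>e \<theta>0 :: real
    and xs x0 :: "real^2"
    and x :: "real \<Rightarrow> real^2"
    and \<theta> :: "real \<Rightarrow> real"
  assumes "\<kappa>r > 0"
    and "0 < \<kappa>e" and "\<kappa>e < 1"
    and "\<theta>0 \<in> {-pi..<pi}"
    and "closed_loop_trajectory \<kappa>r \<kappa>e xs x \<theta>"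
    and "x 0 = x0" and "\<theta> 0 = \<theta>0"
  shows "\<forall>t\<ge>0. x t \<in> motion_ball \<kappa>e xs x0 \<theta>0"
proof -
  interpret headway_motion \<kappa>r \<kappa>e xs x \<theta>
    using assms by unfold_locales
  show ?thesis
    using in_motion_ball assms by blast
qed

end
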